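(* Let $k=\mathbb{C}$, let $X\subset\mathbb{A}^3$ be the closed subvariety defined by $x^2+y^2+\left(z-\tfrac12\right)^2=\tfrac14$, and let $$\phi:X\longrightarrow\mathbb{A}^3,\qquad (x,y,z)\longmapsto\big((1-2z)x,\,(1-3z)y,\,(1-z)z\big).$$ Let $Y=\phi(X)$ be the image of $\phi$, and let $W=\phi\big(X\cap V(z-\tfrac14)\big)\subset Y$. Then $\phi$ is a finite morphism, and $$\phi^{-1}(W)=\left(X\cap V\left(z-\tfrac14\right)\right)\cup\left\{\left(\tfrac{\sqrt3}{4},0,\tfrac34\right),\left(-\tfrac{\sqrt3}{4},0,\tfrac34\right)\right\}.$$ In particular, $Z:=\left\{\left(-\tfrac{\sqrt3}{4},0,\tfrac34\right)\right\}$ is an irreducible component of $\phi^{-1}(W)$ such that $\phi(Z)\neq W$.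
   Context: $\mathbb{A}^3$ is affine $3$-space over $\mathbb{C}$ with coordinates $x,y,z$. $V(g)$ denotes the zero locus of the polynomial $g$ in $\mathbb{A}^3$. A morphism of affine algebraic sets is finite if the induced homomorphism of coordinate rings makes the coordinate ring of the source a finite module (equivalently, here, integral) over the coordinate ring of the target. *)

theory Defs
  imports "HOL-Analysis.Analysis" "HOL-Algebra.Ring" "HOL-Library.Poly_Mapping"
begin

section \<open>Polynomials in several variables\<close>

text \<open>Polynomials over the complex numbers, with variables indexed by the finite type
  \<open>'n\<close>: finitely supported maps from exponent vectors to coefficients.\<close>

type_synonym 'n mpoly = "('n \<Rightarrow>\<^sub>0 nat) \<Rightarrow>\<^sub>0 complex"

definition mvar :: "'n \<Rightarrow> 'n mpoly"
  where "mvar i = Poly_Mapping.single (Poly_Mapping.single i 1) 1"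

definition mconst :: "complex \<Rightarrow> 'n mpoly"
  where "mconst c = Poly_Mapping.single 0 c"

definition monom_eval :: "('n \<Rightarrow>\<^sub>0 nat) \<Rightarrow> complex ^ 'n::finite \<Rightarrow> complex"
  where "monom_eval m a = (\<Prod>i\<in>UNIV. (a $ i) ^ Poly_Mapping.lookup m i)"

definition meval :: "'n::finite mpoly \<Rightarrow> complex ^ 'n \<Rightarrow> complex"
  where "meval p a =
    (\<Sum>m\<in>Poly_Mapping.keys p. Poly_Mapping.lookup p m * monom_eval m a)"

lemma monom_eval_add: "monom_eval (m + m') a = monom_eval m a * monom_eval m' a"
  by (simp add: monom_eval_def lookup_add power_add prod.distrib)

lemma monom_eval_0 [simp]: "monom_eval 0 a = 1"
  by (simp add: monom_eval_def)

lemma meval_superset: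
  assumes "finite S" "Poly_Mapping.keys p \<subseteq> S"
  shows "meval p a = (\<Sum>m\<in>S. Poly_Mapping.lookup p m * monom_eval m a)"
  unfolding meval_def using assms
  by (intro sum.mono_neutral_left) (auto simp: in_keys_iff)

lemma meval_0 [simp]: "meval 0 a = 0"
  by (simp add: meval_def)

lemma meval_single [simp]: "meval (Poly_Mapping.single m c) a = c * monom_eval m a"
  using meval_superset[of "{m}" "Poly_Mapping.single m c" a] by simp

lemma meval_add [simp]: "meval (p + q) a = meval p a + meval q a"
proof -
  let ?S = "Poly_Mapping.keys p \<union> Poly_Mapping.keys q"
  have "Poly_Mapping.keys (p + q) \<subseteq> ?S" by (rule keys_add)
  then show ?thesis
    by (simp add: meval_superset[of ?S] lookup_add distrib_right sum.distrib)
qed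

lemma meval_uminus [simp]: "meval (- p) a = - meval p a"
  using meval_add[of p "- p" a] by (simp add: add_eq_0_iff)

lemma meval_diff [simp]: "meval (p - q) a = meval p a - meval q a"
  using meval_add[of p "- q" a] by simp

lemma meval_mult_single:
  "meval (p * Poly_Mapping.single m c) a = meval p a * (c * monom_eval m a)"
proof (induction p rule: update_induct)
  case const
  then show ?case by simp
next
  case (update f k b)
  have eq: "Poly_Mapping.update k b f = f + Poly_Mapping.single k b"
    using update(1)
    by (intro poly_mapping_eqI)
       (auto simp: lookup_update lookup_add lookup_single in_keys_iff when_def)
  show ?case
    unfolding eq distrib_right meval_add update.IH
    by (simp add: mult_single monom_eval_add algebra_simps)
qed

lemma meval_mult [simp]: "meval (p * q) a = meval p a * meval q a"
proof (induction q rule: update_induct)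
  case const
  then show ?case by simp
next
  case (update f k b)
  have eq: "Poly_Mapping.update k b f = f + Poly_Mapping.single k b"
    using update(1)
    by (intro poly_mapping_eqI)
       (auto simp: lookup_update lookup_add lookup_single in_keys_iff when_def)
  show ?case
    unfolding eq distrib_left meval_add update.IH
    by (simp add: meval_mult_single)
qed

lemma meval_mconst [simp]: "meval (mconst c) a = c"
  by (simp add: mconst_def)

lemma meval_1 [simp]: "meval 1 a = 1"
  unfolding single_one[symmetric] by (subst meval_single) simp

lemma meval_power [simp]: "meval (p ^ k) a = meval p a ^ k"
  by (induction k) simp_all

lemma meval_mvar [simp]: "meval (mvar i) a = a $ i"
proof -
  have "(\<Prod>j\<in>UNIV. (a $ j) ^ (1 when i = j)) = (\<Prod>j\<in>{i}. (a $ j) ^ (1 when i = j))"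
    by (rule prod.mono_neutral_right) (auto simp: when_def)
  then show ?thesis
    by (simp add: mvar_def monom_eval_def lookup_single)
qed


section \<open>Zero loci and the Zariski topology\<close>

definition zero_locus :: "'n::finite mpoly set \<Rightarrow> (complex ^ 'n) set"
  where "zero_locus P = {a. \<forall>p\<in>P. meval p a = 0}"

definition zariski :: "(complex ^ 'n::finite) topology"
  where "zariski = topology (\<lambda>U. \<exists>P. U = - zero_locus P)"

lemma zero_locus_Un: "zero_locus P \<union> zero_locus Q = zero_locus {p * q |p q. p \<in> P \<and> q \<in> Q}"
proof -
  have "a \<in> zero_locus P \<union> zero_locus Q"
    if *: "a \<in> zero_locus {p * q |p q. p \<in> P \<and> q \<in> Q}" for a
  proof (rule ccontr)
    assume "a \<notin> zero_locus P \<union> zero_locus Q"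
    then obtain p q where pq: "p \<in> P" "q \<in> Q" "meval p a \<noteq> 0" "meval q a \<noteq> 0"
      by (auto simp: zero_locus_def)
    then have "p * q \<in> {p * q |p q. p \<in> P \<and> q \<in> Q}" by blast
    with * have "meval (p * q) a = 0"
      unfolding zero_locus_def by blast
    with pq show False by simp
  qed
  then show ?thesis by (auto simp: zero_locus_def)
qed

lemma openin_zariski:
  fixes U :: "(complex ^ 'n::finite) set"
  shows "openin zariski U \<longleftrightarrow> (\<exists>P. U = - zero_locus P)"
proof -
  have "istopology (\<lambda>U :: (complex ^ 'n) set. \<exists>P. U = - zero_locus P)"
    unfolding istopology_def
  proof (intro conjI allI impI)
    fix S T :: "(complex ^ 'n) set"
    assume "\<exists>P. S = - zero_locus P" "\<exists>P. T = - zero_locus P"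
    then obtain P Q where "S = - zero_locus P" "T = - zero_locus Q"
      by blast
    then have "S \<inter> T = - zero_locus {p * q |p q. p \<in> P \<and> q \<in> Q}"
      by (simp flip: zero_locus_Un)
    then show "\<exists>P. S \<inter> T = - zero_locus P" ..
  next
    fix K :: "(complex ^ 'n) set set"
    assume "\<forall>S\<in>K. \<exists>P. S = - zero_locus P"
    then obtain P where P: "\<And>S. S \<in> K \<Longrightarrow> S = - zero_locus (P S)"
      by metis
    have "\<Union>K = - zero_locus (\<Union>S\<in>K. P S)"
    proof (rule Set.set_eqI)
      fix a
      have "a \<in> \<Union>K \<longleftrightarrow> (\<exists>S\<in>K. a \<in> - zero_locus (P S))"
        using P by blast
      then show "a \<in> \<Union>K \<longleftrightarrow> a \<in> - zero_locus (\<Union>S\<in>K. P S)"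
        by (auto simp: zero_locus_def)
    qed
    then show "\<exists>P. \<Union>K = - zero_locus P" ..
  qed
  then show ?thesis by (simp add: zariski_def topology_inverse')
qed

lemma topspace_zariski [simp]: "topspace zariski = UNIV"
proof -
  have "openin zariski (- zero_locus {1})"
    by (auto simp: openin_zariski)
  moreover have "- zero_locus {1} = UNIV"
    by (auto simp: zero_locus_def)
  ultimately show ?thesis
    by (metis openin_subset top.extremum_uniqueI)
qed

lemma closedin_zariski: "closedin zariski S \<longleftrightarrow> (\<exists>P. S = zero_locus P)"
  by (simp add: closedin_def openin_zariski flip: Compl_eq_Diff_UNIV)

definition irreducible_in :: "'a topology \<Rightarrow> 'a set \<Rightarrow> bool"
  where "irreducible_in T S \<longleftrightarrow> S \<subseteq> topspace T \<and> S \<noteq> {} \<and>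
    (\<forall>A B. closedin T A \<and> closedin T B \<and> S \<subseteq> A \<union> B \<longrightarrow> S \<subseteq> A \<or> S \<subseteq> B)"

definition irreducible_component :: "'a topology \<Rightarrow> 'a set \<Rightarrow> bool"
  where "irreducible_component T C \<longleftrightarrow> irreducible_in T C \<and>
    (\<forall>D. irreducible_in T D \<and> C \<subseteq> D \<longrightarrow> D = C)"


section \<open>Coordinate rings and finite morphisms\<close>

text \<open>The coordinate ring of \<open>X\<close> is the ring of polynomial functions on \<open>X\<close>. Two
  polynomials give the same function exactly when they differ by an element of the
  vanishing ideal, so this is the polynomial ring modulo that ideal. Functions on \<open>X\<close> are
  represented by their extensional version (\<open>undefined\<close> outside \<open>X\<close>).\<close>

definition coord_ring :: "(complex ^ 'n::finite) set \<Rightarrow> (complex ^ 'n \<Rightarrow> complex) ring"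
  where "coord_ring X = \<lparr>
    carrier = {restrict (meval p) X |p. True},
    monoid.mult = (\<lambda>f g. restrict (\<lambda>a. f a * g a) X),
    one = restrict (\<lambda>a. 1) X,
    zero = restrict (\<lambda>a. 0) X,
    add = (\<lambda>f g. restrict (\<lambda>a. f a + g a) X)\<rparr>"

lemma cring_coord_ring: "cring (coord_ring X)"
proof (rule cringI)
  show "abelian_group (coord_ring X)"
  proof (rule abelian_groupI)
    fix f g assume "f \<in> carrier (coord_ring X)" "g \<in> carrier (coord_ring X)"
    then obtain p q where "f = restrict (meval p) X" "g = restrict (meval q) X"
      by (auto simp: coord_ring_def)
    then have "f \<oplus>\<^bsub>coord_ring X\<^esub> g = restrict (meval (p + q)) X"
      by (auto simp: coord_ring_def restrict_def)
    then show "f \<oplus>\<^bsub>coord_ring X\<^esub> g \<in> carrier (coord_ring X)"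
      by (auto simp: coord_ring_def)
  next
    have "\<zero>\<^bsub>coord_ring X\<^esub> = restrict (meval 0) X"
      by (auto simp: coord_ring_def restrict_def)
    then show "\<zero>\<^bsub>coord_ring X\<^esub> \<in> carrier (coord_ring X)"
      by (auto simp: coord_ring_def)
  next
    fix f assume "f \<in> carrier (coord_ring X)"
    then obtain p where "f = restrict (meval p) X"
      by (auto simp: coord_ring_def)
    then show "\<exists>g\<in>carrier (coord_ring X). g \<oplus>\<^bsub>coord_ring X\<^esub> f = \<zero>\<^bsub>coord_ring X\<^esub>"
      by (intro Set.bexI[of _ "restrict (meval (- p)) X"])
         (auto simp: coord_ring_def restrict_def)
  qed (auto simp: coord_ring_def restrict_def fun_eq_iff)
  show "Group.comm_monoid (coord_ring X)"
  proof (rule Group.comm_monoidI)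
    fix f g assume "f \<in> carrier (coord_ring X)" "g \<in> carrier (coord_ring X)"
    then obtain p q where "f = restrict (meval p) X" "g = restrict (meval q) X"
      by (auto simp: coord_ring_def)
    then have "f \<otimes>\<^bsub>coord_ring X\<^esub> g = restrict (meval (p * q)) X"
      by (auto simp: coord_ring_def restrict_def)
    then show "f \<otimes>\<^bsub>coord_ring X\<^esub> g \<in> carrier (coord_ring X)"
      by (auto simp: coord_ring_def)
  next
    have "\<one>\<^bsub>coord_ring X\<^esub> = restrict (meval 1) X"
      by (auto simp: coord_ring_def restrict_def)
    then show "\<one>\<^bsub>coord_ring X\<^esub> \<in> carrier (coord_ring X)"
      by (auto simp: coord_ring_def)
  qed (auto simp: coord_ring_def restrict_def fun_eq_iff)
qed (auto simp: coord_ring_def restrict_def fun_eq_iff distrib_right)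

text \<open>\<open>S\<close> is finitely generated as an \<open>R\<close>-module via the ring homomorphism \<open>h\<close>.\<close>

definition finite_ring_hom :: "('a, 'c) ring_scheme \<Rightarrow> ('b, 'd) ring_scheme \<Rightarrow> ('a \<Rightarrow> 'b) \<Rightarrow> bool"
  where "finite_ring_hom R S h \<longleftrightarrow> h \<in> ring_hom R S \<and>
    (\<exists>B. finite B \<and> B \<subseteq> carrier S \<and>
      (\<forall>s\<in>carrier S. \<exists>c\<in>B \<rightarrow> carrier R. s = (\<Oplus>\<^bsub>S\<^esub>b\<in>B. h (c b) \<otimes>\<^bsub>S\<^esub> b)))"

text \<open>Only the values of \<open>\<phi>\<close> on \<open>X\<close> matter below.\<close>

definition alg_morphism ::
    "(complex ^ 'm::finite) set \<Rightarrow> (complex ^ 'n::finite) set \<Rightarrow> (complex ^ 'm \<Rightarrow> complex ^ 'n) \<Rightarrow> bool"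
  where "alg_morphism X Y \<phi> \<longleftrightarrow>
    closedin zariski X \<and> closedin zariski Y \<and> \<phi> ` X \<subseteq> Y \<and>
    (\<exists>p. \<forall>a\<in>X. \<forall>i. \<phi> a $ i = meval (p i) a)"

definition pullback ::
    "(complex ^ 'm::finite) set \<Rightarrow> (complex ^ 'm \<Rightarrow> complex ^ 'n::finite) \<Rightarrow>
      (complex ^ 'n \<Rightarrow> complex) \<Rightarrow> complex ^ 'm \<Rightarrow> complex"
  where "pullback X \<phi> g = restrict (g \<circ> \<phi>) X"

definition finite_morphism ::
    "(complex ^ 'm::finite) set \<Rightarrow> (complex ^ 'n::finite) set \<Rightarrow> (complex ^ 'm \<Rightarrow> complex ^ 'n) \<Rightarrow> bool"
  where "finite_morphism X Y \<phi> \<longleftrightarrow> alg_morphism X Y \<phi> \<and>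
    finite_ring_hom (coord_ring Y) (coord_ring X) (pullback X \<phi>)"

end

theory Submission
  imports Defs
begin

text \<open>Finiteness: \<open>z\<close> is integral because \<open>z\<^sup>2 = z - w\<close>, where \<open>(u, v, w)\<close> are the
  coordinates of \<open>\<phi>\<close>. The polynomials \<open>(1 - 2z)\<^sup>2\<close> and \<open>(1 - 3z)\<^sup>2\<close> generate the unit ideal,
  with coefficients \<open>108z - 27\<close> and \<open>28 - 48z\<close> obtained by cubing
  \<open>3(1 - 2z) - 2(1 - 3z) = 1\<close>. Since \<open>(1 - 2z)\<^sup>2 = 1 - 4w\<close> and \<open>x\<^sup>2 + y\<^sup>2 = w\<close> on \<open>X\<close>, this gives
  \<open>y\<^sup>2 = (108z - 27)((1 - 4w)w - u\<^sup>2) + (28 - 48z)v\<^sup>2\<close>, and then \<open>x\<^sup>2 = w - y\<^sup>2\<close>. Hence the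
  squarefree monomials in \<open>x, y, z\<close> generate the coordinate ring of \<open>X\<close>.

  Fibres: the value \<open>w = 3/16\<close> leaves \<open>z = 1/4\<close> or \<open>z = 3/4\<close>. If \<open>(x', y', 3/4)\<close> has
  the same image as \<open>(x, y, 1/4)\<close>, then \<open>x = - x'\<close> and \<open>y = - 5y'\<close>, and the equation of \<open>X\<close>
  forces \<open>y' = 0\<close>.\<close>

section \<open>Polynomial maps\<close>

lemma meval_sum [simp]: "meval (\<Sum>i\<in>I. p i) a = (\<Sum>i\<in>I. meval (p i) a)"
  by (induction I rule: infinite_finite_induct) simp_all

lemma meval_prod [simp]: "meval (\<Prod>i\<in>I. p i) a = (\<Prod>i\<in>I. meval (p i) a)"
  by (induction I rule: infinite_finite_induct) simp_all

text \<open>Substitution of polynomials into a polynomial. This is what makes pullback along a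
  polynomial map carry polynomial functions to polynomial functions.\<close>

lemma meval_compose:
  fixes q :: "'n::finite mpoly" and p :: "'n \<Rightarrow> 'm::finite mpoly"
  shows "\<exists>r. \<forall>a b. (\<forall>i. b $ i = meval (p i) a) \<longrightarrow> meval q b = meval r a"
proof -
  let ?r = "\<Sum>m\<in>Poly_Mapping.keys q. mconst (Poly_Mapping.lookup q m) *
    (\<Prod>i\<in>UNIV. p i ^ Poly_Mapping.lookup m i)"
  have "\<forall>a b. (\<forall>i. b $ i = meval (p i) a) \<longrightarrow> meval q b = meval ?r a"
    by (simp add: meval_def[of q] monom_eval_def)
  then show ?thesis by blast
qed

lemma pullback_ring_hom:
  assumes "alg_morphism X Y \<phi>"
  shows "pullback X \<phi> \<in> ring_hom (coord_ring Y) (coord_ring X)"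
proof (rule ring_hom_memI)
  obtain p where p: "\<And>a i. a \<in> X \<Longrightarrow> \<phi> a $ i = meval (p i) a" and XY: "\<phi> ` X \<subseteq> Y"
    using assms by (auto simp: alg_morphism_def)
  show "pullback X \<phi> f \<in> carrier (coord_ring X)" if "f \<in> carrier (coord_ring Y)" for f
  proof -
    from that obtain q where q: "f = restrict (meval q) Y" by (auto simp: coord_ring_def)
    obtain r where "\<forall>a b. (\<forall>i. b $ i = meval (p i) a) \<longrightarrow> meval q b = meval r a"
      using meval_compose by blast
    with p XY have "pullback X \<phi> f = restrict (meval r) X"
      by (auto simp: pullback_def q fun_eq_iff restrict_def)
    then show ?thesis by (auto simp: coord_ring_def)
  qed
  show "pullback X \<phi> (f \<otimes>\<^bsub>coord_ring Y\<^esub> g) = pullback X \<phi> f \<otimes>\<^bsub>coord_ring X\<^esub> pullback X \<phi> g" for f g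
    using XY by (auto simp: pullback_def coord_ring_def fun_eq_iff restrict_def)
  show "pullback X \<phi> (f \<oplus>\<^bsub>coord_ring Y\<^esub> g) = pullback X \<phi> f \<oplus>\<^bsub>coord_ring X\<^esub> pullback X \<phi> g" for f g
    using XY by (auto simp: pullback_def coord_ring_def fun_eq_iff restrict_def)
  show "pullback X \<phi> \<one>\<^bsub>coord_ring Y\<^esub> = \<one>\<^bsub>coord_ring X\<^esub>"
    using XY by (auto simp: pullback_def coord_ring_def fun_eq_iff restrict_def)
qed

text \<open>Turns the abstract ring sum in \<open>finite_ring_hom\<close> into a pointwise one, so
  that an expansion in generators can be checked on values.\<close>

lemma finsum_coord_ring:
  assumes "finite B" "f \<in> B \<rightarrow> carrier (coord_ring X)"
  shows "finsum (coord_ring X) f B = restrict (\<lambda>a. \<Sum>b\<in>B. f b a) X"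
  using assms
proof (induction B)
  case empty
  interpret cring "coord_ring X" by (rule cring_coord_ring)
  show ?case by simp (simp add: coord_ring_def)
next
  case (insert b B)
  interpret cring "coord_ring X" by (rule cring_coord_ring)
  have "finsum (coord_ring X) f (insert b B) = f b \<oplus>\<^bsub>coord_ring X\<^esub> finsum (coord_ring X) f B"
    using insert by (intro finsum_insert) auto
  also have "finsum (coord_ring X) f B = restrict (\<lambda>a. \<Sum>b\<in>B. f b a) X"
    using insert by auto
  finally show ?case
    using insert by (auto simp: coord_ring_def fun_eq_iff restrict_def)
qed


section \<open>A criterion for finiteness\<close>

text \<open>The module generated by \<open>B\<close> over the polynomials on the target, acting
  through \<phi>. Coefficients are plain polynomials and values off \<open>X\<close> are free, which
  keeps \<open>restrict\<close> out of the computations.\<close>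

definition pullback_span ::
    "(complex ^ 'm::finite) set \<Rightarrow> (complex ^ 'm \<Rightarrow> complex ^ 'n::finite) \<Rightarrow>
      (complex ^ 'm \<Rightarrow> complex) set \<Rightarrow> (complex ^ 'm \<Rightarrow> complex) set"
  where "pullback_span X \<phi> B =
    {f. \<exists>c. \<forall>a\<in>X. f a = (\<Sum>b\<in>B. meval (c b) (\<phi> a) * b a)}"

lemma pullback_span_cong:
  "f \<in> pullback_span X \<phi> B \<Longrightarrow> (\<And>a. a \<in> X \<Longrightarrow> g a = f a) \<Longrightarrow> g \<in> pullback_span X \<phi> B"
  by (auto simp: pullback_span_def)

lemma pullback_span_0: "(\<lambda>a. 0) \<in> pullback_span X \<phi> B"
  by (auto simp: pullback_span_def intro!: exI[of _ "\<lambda>_. 0"])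

lemma pullback_span_add:
  assumes "f \<in> pullback_span X \<phi> B" "g \<in> pullback_span X \<phi> B"
  shows "(\<lambda>a. f a + g a) \<in> pullback_span X \<phi> B"
proof -
  from assms obtain c d where
    "\<forall>a\<in>X. f a = (\<Sum>b\<in>B. meval (c b) (\<phi> a) * b a)"
    "\<forall>a\<in>X. g a = (\<Sum>b\<in>B. meval (d b) (\<phi> a) * b a)"
    by (auto simp: pullback_span_def)
  then have "\<forall>a\<in>X. f a + g a = (\<Sum>b\<in>B. meval (c b + d b) (\<phi> a) * b a)"
    by (simp add: distrib_right sum.distrib)
  then show ?thesis unfolding pullback_span_def
    by (intro CollectI exI[of _ "\<lambda>b. c b + d b"])
qed

lemma pullback_span_smult:
  assumes "f \<in> pullback_span X \<phi> B"
  shows "(\<lambda>a. meval p (\<phi> a) * f a) \<in> pullback_span X \<phi> B"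
proof -
  from assms obtain c where "\<forall>a\<in>X. f a = (\<Sum>b\<in>B. meval (c b) (\<phi> a) * b a)"
    by (auto simp: pullback_span_def)
  then have "\<forall>a\<in>X. meval p (\<phi> a) * f a = (\<Sum>b\<in>B. meval (p * c b) (\<phi> a) * b a)"
    by (simp add: sum_distrib_left mult.assoc)
  then show ?thesis unfolding pullback_span_def
    by (intro CollectI exI[of _ "\<lambda>b. p * c b"])
qed

lemma pullback_span_sum:
  "(\<And>i. i \<in> I \<Longrightarrow> f i \<in> pullback_span X \<phi> B) \<Longrightarrow> (\<lambda>a. \<Sum>i\<in>I. f i a) \<in> pullback_span X \<phi> B"
  by (induction I rule: infinite_finite_induct)
     (simp_all add: pullback_span_0 pullback_span_add)

lemma pullback_span_base:
  assumes "finite B" "b \<in> B"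
  shows "b \<in> pullback_span X \<phi> B"
proof -
  have "b a = (\<Sum>b'\<in>B. meval (if b' = b then 1 else 0) (\<phi> a) * b' a)" for a
  proof -
    have "(\<Sum>b'\<in>B. meval (if b' = b then 1 else 0) (\<phi> a) * b' a) =
        (\<Sum>b'\<in>B. if b' = b then b' a else 0)"
      by (rule sum.cong) auto
    then show ?thesis using assms by simp
  qed
  then show ?thesis unfolding pullback_span_def
    by (intro CollectI exI[of _ "\<lambda>b'. if b' = b then 1 else 0"] ballI)
qed

text \<open>Multiplication by \<open>g\<close> commutes with the pulled-back coefficients, so
  stability of the span need only be tested on generators.\<close>

lemma pullback_span_mult:
  assumes g: "\<And>b. b \<in> B \<Longrightarrow> (\<lambda>a. g a * b a) \<in> pullback_span X \<phi> B"
    and "f \<in> pullback_span X \<phi> B"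
  shows "(\<lambda>a. g a * f a) \<in> pullback_span X \<phi> B"
proof -
  from assms(2) obtain c where c: "\<forall>a\<in>X. f a = (\<Sum>b\<in>B. meval (c b) (\<phi> a) * b a)"
    by (auto simp: pullback_span_def)
  have "(\<lambda>a. \<Sum>b\<in>B. meval (c b) (\<phi> a) * (g a * b a)) \<in> pullback_span X \<phi> B"
    by (intro pullback_span_sum pullback_span_smult g)
  then show ?thesis
    by (rule pullback_span_cong) (simp add: c sum_distrib_left mult_ac)
qed

text \<open>A span that contains 1 and is stable under every coordinate contains all powers, then
  all monomials, then all polynomials, hence the whole coordinate ring of \<open>X\<close>.\<close>

lemma finite_morphismI:
  fixes X :: "(complex ^ 'm::finite) set" and \<phi> :: "complex ^ 'm \<Rightarrow> complex ^ 'n::finite"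
  assumes \<phi>: "alg_morphism X Y \<phi>"
    and B: "finite B" "B \<subseteq> carrier (coord_ring X)"
    and one: "(\<lambda>a. 1) \<in> pullback_span X \<phi> B"
    and var: "\<And>i b. b \<in> B \<Longrightarrow> (\<lambda>a. a $ i * b a) \<in> pullback_span X \<phi> B"
  shows "finite_morphism X Y \<phi>"
proof -
  have pow: "(\<lambda>a. a $ i ^ k * f a) \<in> pullback_span X \<phi> B" if "f \<in> pullback_span X \<phi> B" for f i k
  proof (induction k)
    case (Suc k)
    have "(\<lambda>a. a $ i * (a $ i ^ k * f a)) \<in> pullback_span X \<phi> B"
      by (rule pullback_span_mult[OF var Suc])
    then show ?case by (simp add: mult.assoc)
  qed (use that in simp)
  have prd: "(\<lambda>a. \<Prod>i\<in>I. a $ i ^ k i) \<in> pullback_span X \<phi> B" for I and k :: "'m \<Rightarrow> nat"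
    by (induction I rule: infinite_finite_induct) (simp_all add: one pow)
  have span: "meval p \<in> pullback_span X \<phi> B" for p
  proof -
    have "(\<lambda>a. \<Sum>m\<in>Poly_Mapping.keys p.
        meval (mconst (Poly_Mapping.lookup p m)) (\<phi> a) * monom_eval m a) \<in> pullback_span X \<phi> B"
      unfolding monom_eval_def by (intro pullback_span_sum pullback_span_smult prd)
    then show ?thesis by (rule pullback_span_cong) (simp add: meval_def[of p])
  qed
  have XY: "\<phi> ` X \<subseteq> Y" using \<phi> by (simp add: alg_morphism_def)
  interpret R: cring "coord_ring X" by (rule cring_coord_ring)
  have "\<exists>c\<in>B \<rightarrow> carrier (coord_ring Y).
      s = (\<Oplus>\<^bsub>coord_ring X\<^esub>b\<in>B. pullback X \<phi> (c b) \<otimes>\<^bsub>coord_ring X\<^esub> b)"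
    if "s \<in> carrier (coord_ring X)" for s
  proof -
    from that obtain p where s: "s = restrict (meval p) X" by (auto simp: coord_ring_def)
    obtain c where c: "\<And>a. a \<in> X \<Longrightarrow> meval p a = (\<Sum>b\<in>B. meval (c b) (\<phi> a) * b a)"
      using span[of p] by (auto simp: pullback_span_def)
    \<comment> \<open>Restriction to \<open>Y\<close> makes the coefficients elements of its
      coordinate ring; their values at \<open>\<phi> a\<close> survive because \<phi> maps
      \<open>X\<close> into \<open>Y\<close>.\<close>
    let ?c = "\<lambda>b. restrict (meval (c b)) Y"
    have mem: "?c \<in> B \<rightarrow> carrier (coord_ring Y)" by (auto simp: coord_ring_def)
    have "(\<lambda>b. pullback X \<phi> (?c b) \<otimes>\<^bsub>coord_ring X\<^esub> b) \<in> B \<rightarrow> carrier (coord_ring X)"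
      using B(2) mem ring_hom_closed[OF pullback_ring_hom[OF \<phi>]] by (auto intro!: R.m_closed)
    then have "(\<Oplus>\<^bsub>coord_ring X\<^esub>b\<in>B. pullback X \<phi> (?c b) \<otimes>\<^bsub>coord_ring X\<^esub> b) =
        restrict (\<lambda>a. \<Sum>b\<in>B. (pullback X \<phi> (?c b) \<otimes>\<^bsub>coord_ring X\<^esub> b) a) X"
      using B(1) by (rule finsum_coord_ring[rotated])
    also have "\<dots> = s"
      unfolding s using XY
      by (intro restrict_ext) (auto simp: c coord_ring_def pullback_def intro!: sum.cong)
    finally show ?thesis using mem by (intro bexI[of _ ?c]) simp_all
  qed
  then show ?thesis
    unfolding finite_morphism_def finite_ring_hom_def
    using \<phi> B pullback_ring_hom[OF \<phi>] by blast
qed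


section \<open>The sphere\<close>

text \<open>Expanding the square, with \<open>s\<close> standing for x^2 + y^2. The right side is
  the third coordinate w of \<phi>, so \<open>X\<close> is x^2 + y^2 = w.\<close>

lemma sphere_eq_iff: "s + (z - 1/2)\<^sup>2 = 1/4 \<longleftrightarrow> s = (1 - z) * z" for s z :: complex
proof -
  have "s + (z - 1/2)\<^sup>2 - 1/4 = s - (1 - z) * z"
    by (simp add: power2_eq_square field_simps)
  then show ?thesis by (metis eq_iff_diff_eq_0)
qed

lemma finite_morphism_sphere:
  fixes X :: "(complex ^ 3) set" and \<phi> :: "complex ^ 3 \<Rightarrow> complex ^ 3"
  assumes X: "X = {a. (a $ 1)\<^sup>2 + (a $ 2)\<^sup>2 + (a $ 3 - 1/2)\<^sup>2 = 1/4}"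
    and \<phi>: "\<forall>a\<in>X. \<phi> a =
      vector [(1 - 2 * a $ 3) * a $ 1, (1 - 3 * a $ 3) * a $ 2, (1 - a $ 3) * a $ 3]"
  shows "finite_morphism X UNIV \<phi>"
proof -
  have closed: "closedin zariski X"
    unfolding closedin_zariski
    by (rule exI[of _ "{mvar 1 ^ 2 + mvar 2 ^ 2 + (mvar 3 - mconst (1/2)) ^ 2 - mconst (1/4)}"])
       (simp add: X zero_locus_def)
  have "closedin zariski (UNIV :: (complex ^ 3) set)"
    by (metis closedin_topspace topspace_zariski)
  moreover have "\<exists>p. \<forall>a\<in>X. \<forall>i. \<phi> a $ i = meval (p i) a"
    by (rule exI[of _ "\<lambda>i. if i = 1 then (1 - mconst 2 * mvar 3) * mvar 1 else
          if i = 2 then (1 - mconst 3 * mvar 3) * mvar 2 else (1 - mvar 3) * mvar 3"])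
       (simp add: \<phi> forall_3)
  ultimately have alg: "alg_morphism X UNIV \<phi>"
    using closed by (simp add: alg_morphism_def)

  \<comment> \<open>The eight squarefree monomials, cut down to \<open>X\<close> since elements of
    the coordinate ring are extensional; \<open>?m\<close> is the uncut version.\<close>
  define e where "e i j k = restrict (\<lambda>a. a $ 1 ^ i * a $ 2 ^ j * a $ 3 ^ k) X" for i j k :: nat
  define B where "B = (\<lambda>(i, j, k). e i j k) ` ({0, 1} \<times> {0, 1} \<times> {0, 1})"
  let ?M = "pullback_span X \<phi> B"
  let ?m = "\<lambda>i j k. \<lambda>a::complex^3. a $ 1 ^ i * a $ 2 ^ j * a $ 3 ^ k"
  have "finite B" by (simp add: B_def)
  have "e i j k = restrict (meval (mvar 1 ^ i * mvar 2 ^ j * mvar 3 ^ k)) X" for i j k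
    by (simp add: e_def fun_eq_iff restrict_def)
  then have carr: "B \<subseteq> carrier (coord_ring X)"
    by (auto simp: B_def coord_ring_def)
  have base: "?m i j k \<in> ?M" if "i \<in> {0, 1}" "j \<in> {0, 1}" "k \<in> {0, 1}" for i j k
  proof -
    have "e i j k \<in> B" using that by (force simp: B_def)
    from pullback_span_base[OF \<open>finite B\<close> this] show ?thesis
      by (rule pullback_span_cong) (simp add: e_def)
  qed
  \<comment> \<open>Membership in the span depends only on values on \<open>X\<close>, so the
    generators may be traded for the plain monomials \<open>?m\<close>.\<close>
  have mult_B: "(\<lambda>a. g a * b a) \<in> ?M"
    if "\<And>i j k. i \<in> {0, 1} \<Longrightarrow> j \<in> {0, 1} \<Longrightarrow> k \<in> {0, 1} \<Longrightarrow> (\<lambda>a. g a * ?m i j k a) \<in> ?M"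
      and "b \<in> B" for g b
  proof -
    from \<open>b \<in> B\<close> obtain i j k where
      ijk: "i \<in> {0, 1}" "j \<in> {0, 1}" "k \<in> {0, 1}" and b: "b = e i j k"
      by (auto simp: B_def)
    show ?thesis by (rule pullback_span_cong[OF that(1)[OF ijk]]) (simp add: b e_def)
  qed
  note lin = pullback_span_add pullback_span_smult
  let ?u = "mvar 1 :: 3 mpoly" and ?v = "mvar 2 :: 3 mpoly" and ?w = "mvar 3 :: 3 mpoly"
  have z_B: "(\<lambda>a. a $ 3 * b a) \<in> ?M" if "b \<in> B" for b
  proof (rule mult_B[OF _ that])
    fix i j k :: nat assume ij: "i \<in> {0, 1}" "j \<in> {0, 1}" and "k \<in> {0, 1}"
    then consider "k = 0" | "k = 1" by blast
    then show "(\<lambda>a. a $ 3 * ?m i j k a) \<in> ?M"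
    proof cases
      case 1
      show ?thesis
        by (rule pullback_span_cong[OF base[of i j 1]]) (use ij 1 in auto)
    next
      case 2
      \<comment> \<open>Here z^2 = z - w lowers the exponent of z.\<close>
      have "(\<lambda>a. ?m i j 1 a + meval (- ?w) (\<phi> a) * ?m i j 0 a) \<in> ?M"
        using ij by (intro lin base) auto
      then show ?thesis
        by (rule pullback_span_cong) (simp add: 2 \<phi> algebra_simps)
    qed
  qed
  note z_M = pullback_span_mult[OF z_B]
  \<comment> \<open>\<open>P\<close> and \<open>Q\<close> are the z-free part and the coefficient of
    z in the formula for y^2. On \<open>X\<close> the bracket (1 - 4w)w - u^2 equals (1 - 2z)^2 y^2,
    while v^2 = (1 - 3z)^2 y^2.\<close>
  define P where "P = mconst (-27) * ((1 - mconst 4 * ?w) * ?w - ?u ^ 2) + mconst 28 * ?v ^ 2"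
  define Q where "Q = mconst 108 * ((1 - mconst 4 * ?w) * ?w - ?u ^ 2) - mconst 48 * ?v ^ 2"
  have y2: "(a $ 2)\<^sup>2 = meval P (\<phi> a) + meval Q (\<phi> a) * a $ 3" if "a \<in> X" for a
  proof -
    \<comment> \<open>Eliminating x^2 leaves a polynomial identity in y and z alone.\<close>
    have *: "(a $ 1)\<^sup>2 = (1 - a $ 3) * a $ 3 - (a $ 2)\<^sup>2"
      using that unfolding X mem_Collect_eq sphere_eq_iff by (simp add: eq_diff_eq)
    show ?thesis
      using that by (simp add: P_def Q_def \<phi> power_mult_distrib *) (simp add: power2_eq_square algebra_simps)
  qed
  have x2: "(a $ 1)\<^sup>2 = meval (?w - P) (\<phi> a) + meval (- Q) (\<phi> a) * a $ 3" if "a \<in> X" for a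
  proof -
    have *: "(a $ 1)\<^sup>2 = (1 - a $ 3) * a $ 3 - (a $ 2)\<^sup>2"
      using that unfolding X mem_Collect_eq sphere_eq_iff by (simp add: eq_diff_eq)
    show ?thesis unfolding * y2[OF that] using that by (simp add: \<phi>)
  qed
  have y_B: "(\<lambda>a. a $ 2 * b a) \<in> ?M" if "b \<in> B" for b
  proof (rule mult_B[OF _ that])
    fix i j k :: nat assume ik: "i \<in> {0, 1}" "k \<in> {0, 1}" and "j \<in> {0, 1}"
    then consider "j = 0" | "j = 1" by blast
    then show "(\<lambda>a. a $ 2 * ?m i j k a) \<in> ?M"
    proof cases
      case 1
      show ?thesis
        by (rule pullback_span_cong[OF base[of i 1 k]]) (use ik 1 in auto)
    next
      case 2
      \<comment> \<open>As \<open>k\<close> may already be 1, the product with z need not be a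
        generator; \<open>z_M\<close> brings it back into the span.\<close>
      have "(\<lambda>a. meval P (\<phi> a) * ?m i 0 k a + meval Q (\<phi> a) * (a $ 3 * ?m i 0 k a)) \<in> ?M"
        using ik by (intro lin z_M base) auto
      then show ?thesis
      proof (rule pullback_span_cong)
        fix a assume "a \<in> X"
        have "a $ 2 * ?m i j k a = (a $ 2)\<^sup>2 * ?m i 0 k a"
          by (simp add: 2 power2_eq_square)
        then show "a $ 2 * ?m i j k a = meval P (\<phi> a) * ?m i 0 k a + meval Q (\<phi> a) * (a $ 3 * ?m i 0 k a)"
          unfolding y2[OF \<open>a \<in> X\<close>] by (simp add: algebra_simps)
      qed
    qed
  qed
  have x_B: "(\<lambda>a. a $ 1 * b a) \<in> ?M" if "b \<in> B" for b
  proof (rule mult_B[OF _ that])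
    fix i j k :: nat assume jk: "j \<in> {0, 1}" "k \<in> {0, 1}" and "i \<in> {0, 1}"
    then consider "i = 0" | "i = 1" by blast
    then show "(\<lambda>a. a $ 1 * ?m i j k a) \<in> ?M"
    proof cases
      case 1
      show ?thesis
        by (rule pullback_span_cong[OF base[of 1 j k]]) (use jk 1 in auto)
    next
      case 2
      have "(\<lambda>a. meval (?w - P) (\<phi> a) * ?m 0 j k a + meval (- Q) (\<phi> a) * (a $ 3 * ?m 0 j k a)) \<in> ?M"
        using jk by (intro lin z_M base) auto
      then show ?thesis
      proof (rule pullback_span_cong)
        fix a assume "a \<in> X"
        have "a $ 1 * ?m i j k a = (a $ 1)\<^sup>2 * ?m 0 j k a"
          by (simp add: 2 power2_eq_square)
        then show "a $ 1 * ?m i j k a =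
            meval (?w - P) (\<phi> a) * ?m 0 j k a + meval (- Q) (\<phi> a) * (a $ 3 * ?m 0 j k a)"
          unfolding x2[OF \<open>a \<in> X\<close>] by (simp add: algebra_simps)
      qed
    qed
  qed
  show ?thesis
  proof (rule finite_morphismI[OF alg \<open>finite B\<close> carr])
    show "(\<lambda>a. 1) \<in> ?M"
      using base[of 0 0 0] by simp
    show "(\<lambda>a. a $ i * b a) \<in> ?M" if "b \<in> B" for i b
      using x_B[OF that] y_B[OF that] z_B[OF that] exhaust_3[of i] by auto
  qed
qed


section \<open>Irreducible components\<close>

lemma closedin_zariski_singleton: "closedin zariski {a}"
  unfolding closedin_zariski
  by (rule exI[of _ "range (\<lambda>i. mvar i - mconst (a $ i))"])
     (auto simp: zero_locus_def vec_eq_iff)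

text \<open>The closed sets \<open>{a}\<close> and \<open>C\<close> cover the space. An irreducible
  set through \<open>a\<close> lies in one of them, and not in \<open>C\<close>, so it is
  \<open>{a}\<close>.\<close>

lemma irreducible_component_singleton:
  assumes "closedin T {a}" "closedin T C" "a \<notin> C" "topspace T \<subseteq> insert a C"
  shows "irreducible_component T {a}"
proof -
  have "a \<in> topspace T" using closedin_subset[OF assms(1)] by simp
  have "D = {a}" if D: "irreducible_in T D" "{a} \<subseteq> D" for D
  proof -
    have "D \<subseteq> {a} \<union> C" using D(1) assms(4) by (auto simp: irreducible_in_def)
    then have "D \<subseteq> {a} \<or> D \<subseteq> C"
      using D(1) assms(1,2) unfolding irreducible_in_def by blast
    then show ?thesis using D(2) assms(3) by blast
  qed
  then show ?thesis
    using \<open>a \<in> topspace T\<close> by (auto simp: irreducible_component_def irreducible_in_def)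
qed

theorem mainTheorem1:
  fixes X Y W Z :: "(complex ^ 3) set"
    and \<phi> :: "complex ^ 3 \<Rightarrow> complex ^ 3"
  assumes "X = {a. (a $ 1)\<^sup>2 + (a $ 2)\<^sup>2 + (a $ 3 - 1/2)\<^sup>2 = 1/4}"
    and "\<forall>a\<in>X. \<phi> a =
      vector [(1 - 2 * a $ 3) * a $ 1, (1 - 3 * a $ 3) * a $ 2, (1 - a $ 3) * a $ 3]"
    and "Y = \<phi> ` X"
    and "W = \<phi> ` (X \<inter> zero_locus {mvar 3 - mconst (1/4)})"
    and "Z = {vector [- complex_of_real (sqrt 3 / 4), 0, 3/4]}"
  shows "finite_morphism X UNIV \<phi> \<and>
    W \<subseteq> Y \<and>
    {a \<in> X. \<phi> a \<in> W} = (X \<inter> zero_locus {mvar 3 - mconst (1/4)}) \<union>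
      {vector [complex_of_real (sqrt 3 / 4), 0, 3/4],
       vector [- complex_of_real (sqrt 3 / 4), 0, 3/4]} \<and>
    irreducible_component (subtopology zariski {a \<in> X. \<phi> a \<in> W}) Z \<and>
    \<phi> ` Z \<noteq> W"
proof -
  note X = assms(1) and \<phi> = assms(2)
  define r where "r = complex_of_real (sqrt 3 / 4)"
  have r2: "r\<^sup>2 = 3/16"
    by (simp add: r_def power_divide flip: of_real_power)
  then have "r \<noteq> 0" by auto
  define p where "p s t = (vector [s, 0, t] :: complex ^ 3)" for s t
  have pi [simp]: "p s t $ 1 = s" "p s t $ 2 = 0" "p s t $ 3 = t" for s t
    by (simp_all add: p_def)
  let ?H = "zero_locus {mvar 3 - mconst (1/4)} :: (complex ^ 3) set"
  have H: "a \<in> ?H \<longleftrightarrow> a $ 3 = 1/4" for a by (simp add: zero_locus_def)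
  \<comment> \<open>Both heights solve (1 - t)t = 3/16, so on the plane y = 0 the sphere equation
    becomes \<open>s\<^sup>2 = 3/16\<close>.\<close>
  have in_X: "p s t \<in> X" if "s\<^sup>2 = 3/16" "t = 1/4 \<or> t = 3/4" for s t
  proof -
    have "(1 - t) * t = 3/16" using that(2) by (elim disjE; hypsubst) simp_all
    then show ?thesis unfolding X mem_Collect_eq sphere_eq_iff by (simp add: that(1))
  qed
  have \<phi>p: "\<phi> (p s t) = vector [(1 - 2 * t) * s, 0, (1 - t) * t]"
    if "s\<^sup>2 = 3/16" "t = 1/4 \<or> t = 3/4" for s t
    using \<phi> in_X[OF that] by simp
  have sub: "b = p r (3/4) \<or> b = p (- r) (3/4)"
    if b: "b \<in> X" and a: "a \<in> X" "a $ 3 = 1/4" and eq: "\<phi> b = \<phi> a" and "b $ 3 \<noteq> 1/4" for a b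
  proof -
    have e: "(1 - 2 * b $ 3) * b $ 1 = (1 - 2 * a $ 3) * a $ 1"
      "(1 - 3 * b $ 3) * b $ 2 = (1 - 3 * a $ 3) * a $ 2"
      "(1 - b $ 3) * b $ 3 = (1 - a $ 3) * a $ 3"
      using eq a(1) b by (simp_all add: \<phi> vec_eq_iff forall_3)
    \<comment> \<open>The heights with w = 3/16 are the roots 1/4 and 3/4 of t^2 - t + 3/16.\<close>
    have "(b $ 3 - 1/4) * (b $ 3 - 3/4) = 3/16 - (1 - b $ 3) * b $ 3"
      by (simp add: field_simps)
    also have "\<dots> = 0" unfolding e(3) by (simp add: a(2))
    finally have b3: "b $ 3 = 3/4" using \<open>b $ 3 \<noteq> 1/4\<close> by simp
    \<comment> \<open>From z = 1/4 to z = 3/4 the factor 1 - 2z passes from 1/2 to -1/2, and 1 - 3z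
      from 1/4 to -5/4.\<close>
    have a1: "a $ 1 = - b $ 1" and a2: "a $ 2 = - 5 * b $ 2"
      using e(1,2) unfolding a(2) b3 by (simp_all add: field_simps)
    have eqb: "(b $ 1)\<^sup>2 + (b $ 2)\<^sup>2 = 3/16"
      using b unfolding X mem_Collect_eq sphere_eq_iff by (simp add: b3)
    have eqa: "(b $ 1)\<^sup>2 + 25 * (b $ 2)\<^sup>2 = 3/16"
      using a(1) unfolding X mem_Collect_eq sphere_eq_iff by (simp add: a(2) a1 a2 power_mult_distrib)
    \<comment> \<open>Subtracting the sphere equations of the two points cancels x^2.\<close>
    have "24 * (b $ 2)\<^sup>2 = ((b $ 1)\<^sup>2 + 25 * (b $ 2)\<^sup>2) - ((b $ 1)\<^sup>2 + (b $ 2)\<^sup>2)"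
      by simp
    also have "\<dots> = 0" unfolding eqa eqb by simp
    finally have b2: "b $ 2 = 0" by simp
    with eqb have "(b $ 1)\<^sup>2 = r\<^sup>2" by (simp add: r2)
    then have "b $ 1 = r \<or> b $ 1 = - r" by (simp add: power2_eq_iff)
    with b2 b3 show ?thesis by (auto simp: vec_eq_iff forall_3)
  qed
  have fibre: "{a \<in> X. \<phi> a \<in> W} = (X \<inter> ?H) \<union> {p r (3/4), p (- r) (3/4)}" (is "?F = ?G")
  proof
    show "?F \<subseteq> ?G"
    proof
      fix b assume "b \<in> ?F"
      then obtain a where "b \<in> X" "a \<in> X" "a $ 3 = 1/4" "\<phi> b = \<phi> a"
        unfolding assms(4) using H by blast
      from sub[OF this] show "b \<in> ?G" using \<open>b \<in> X\<close> H by blast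
    qed
    have "p s (3/4) \<in> ?F" if "s\<^sup>2 = 3/16" for s
    proof -
      \<comment> \<open>With y = 0 only the sign of 1 - 2z differs, and negating x compensates for
        it.\<close>
      have "\<phi> (p s (3/4)) = \<phi> (p (- s) (1/4))"
        using that by (simp add: \<phi>p)
      moreover have "p (- s) (1/4) \<in> X \<inter> ?H"
        using in_X[of "- s" "1/4"] that by (simp add: H)
      ultimately show ?thesis
        using in_X[of s "3/4"] that unfolding assms(4) by auto
    qed
    then show "?G \<subseteq> ?F"
      using r2 unfolding assms(4) by auto
  qed
  have Z: "Z = {p (- r) (3/4)}" by (simp add: assms(5) p_def r_def)
  have comp: "irreducible_component (subtopology zariski ?F) Z"
    unfolding Z
  proof (rule irreducible_component_singleton)
    have "p (- r) (3/4) \<in> ?F" by (simp add: fibre)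
    then show "closedin (subtopology zariski ?F) {p (- r) (3/4)}"
      by (simp add: closedin_closed_subtopology closedin_zariski_singleton closedin_subset_topspace)
    \<comment> \<open>The union of the planes z = 1/4 and x = r: the first contains the slice, the
      second the other extra point, and neither contains the point of \<open>Z\<close> because r is
      nonzero.\<close>
    let ?C = "zero_locus {(mvar 3 - mconst (1/4)) * (mvar 1 - mconst r)} :: (complex ^ 3) set"
    have "closedin zariski ?C" by (auto simp: closedin_zariski)
    then show "closedin (subtopology zariski ?F) (?F \<inter> ?C)"
      by (auto simp: closedin_subtopology)
    show "p (- r) (3/4) \<notin> ?F \<inter> ?C"
      using \<open>r \<noteq> 0\<close> by (simp add: zero_locus_def)
    show "topspace (subtopology zariski ?F) \<subseteq> insert (p (- r) (3/4)) (?F \<inter> ?C)"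
      unfolding fibre by (auto simp: zero_locus_def)
  qed
  have "\<phi> ` Z \<noteq> W"
  proof
    assume "\<phi> ` Z = W"
    moreover have "\<phi> (p s (1/4)) \<in> W" if "s\<^sup>2 = 3/16" for s
      unfolding assms(4) using in_X[of s "1/4"] that by (auto simp: H)
    ultimately have "\<phi> (p r (1/4)) = \<phi> (p (- r) (1/4))"
      using r2 unfolding Z by auto
    then have "r = - r" by (simp add: \<phi>p r2 vec_eq_iff forall_3)
    with \<open>r \<noteq> 0\<close> show False by simp
  qed
  moreover have "W \<subseteq> Y" by (auto simp: assms(3,4))
  ultimately show ?thesis
    using finite_morphism_sphere[OF X \<phi>] fibre comp by (simp add: p_def r_def)
qed

end
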